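(* For every integer $n\geqslant 0$, $$C_{n+1}(x,y,z)=\sum_{k=0}^n\binom{n}{k}C_k(x,y,z)E_{n-k+1}(x,y,z).$$
   Context: A Stirling permutation of a multiset is a word using each element of the multiset with its multiplicity such that for each value $i$, all letters occurring between two occurrences of $i$ are at least $i$. For $n\geqslant1$, $\mathcal{Q}_n$ is the set of Stirling permutations of $\{1,1,2,2,\ldots,n,n\}$ and $\mathcal{Q}_n^{(1)}$ is the set of Stirling permutations of $\{1,2,2,3,3,\ldots,n,n\}$. For a word $\sigma=\sigma_1\cdots\sigma_L$ set $\sigma_0=\sigma_{L+1}=0$; then ${\rm asc}(\sigma)=\#\{i\in\{0,\ldots,L\}:\sigma_i<\sigma_{i+1}\}$, ${\rm des}(\sigma)=\#\{i\in\{0,\ldots,L\}:\sigma_i>\sigma_{i+1}\}$, ${\rm plat}(\sigma)=\#\{i\in\{0,\ldots,L\}:\sigma_i=\sigma_{i+1}\}$. The trivariate second-order Eulerian polynomials are $C_n(x,y,z)=\sum_{\sigma\in\mathcal{Q}_n}x^{{\rm asc}(\sigma)}y^{{\rm des}(\sigma)}z^{{\rm plat}(\sigma)}$ for $n\geqslant1$, with the convention $C_0(x,y,z)=x$. Also $E_n(x,y,z)=\sum_{\sigma\in\mathcal{Q}_n^{(1)}}x^{{\rm plat}(\sigma)}y^{{\rm des}(\sigma)}z^{{\rm asc}(\sigma)}$ for $n\geqslant 1$. *)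

theory Defs
  imports Main "HOL-Library.Multiset" "HOL-Combinatorics.Multiset_Permutations"
begin

definition stirling_word :: "nat list \<Rightarrow> bool" where
  "stirling_word w \<longleftrightarrow>
     (\<forall>i j k. i < j \<and> j < k \<and> k < length w \<and> w ! i = w ! k \<longrightarrow> w ! i \<le> w ! j)"

definition stirling_permutations :: "nat multiset \<Rightarrow> nat list set" where
  "stirling_permutations M = {w \<in> permutations_of_multiset M. stirling_word w}"

definition Q :: "nat \<Rightarrow> nat list set" where
  "Q n = stirling_permutations (repeat_mset 2 (mset_set {1..n}))"

text \<open>Meaningful for positive \<open>n\<close> only, as the letter 1 is always present.\<close>

definition Q1 :: "nat \<Rightarrow> nat list set" where
  "Q1 n = stirling_permutations (add_mset 1 (repeat_mset 2 (mset_set {2..n})))"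

text \<open>A word padded with a letter 0 at both ends; the statistics range over
  its \<open>length w + 1\<close> pairs of neighbours.\<close>

definition padded :: "nat list \<Rightarrow> nat list" where
  "padded w = 0 # w @ [0]"

definition asc :: "nat list \<Rightarrow> nat" where
  "asc w = card {i \<in> {0..length w}. padded w ! i < padded w ! (i + 1)}"

definition des :: "nat list \<Rightarrow> nat" where
  "des w = card {i \<in> {0..length w}. padded w ! i > padded w ! (i + 1)}"

definition plat :: "nat list \<Rightarrow> nat" where
  "plat w = card {i \<in> {0..length w}. padded w ! i = padded w ! (i + 1)}"

text \<open>
  A polynomial in three indeterminates is represented by its evaluation at elements
  \<open>x\<close>, \<open>y\<close>, \<open>z\<close> of an arbitrary commutative semiring. As the semiring may be a polynomial
  ring and \<open>x\<close>, \<open>y\<close>, \<open>z\<close> its indeterminates, an identity of these functions over all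
  such semirings contains the identity of polynomials.
  The case \<open>n = 0\<close> of \<open>C\<close> is a convention: the sum over the empty word would be \<open>z\<close>.
\<close>

definition C :: "nat \<Rightarrow> 'a \<Rightarrow> 'a \<Rightarrow> 'a \<Rightarrow> 'a::comm_semiring_1" where
  "C n x y z = (if n = 0 then x else (\<Sum>w\<in>Q n. x ^ asc w * y ^ des w * z ^ plat w))"

text \<open>In contrast to \<open>C\<close>, here \<open>x\<close> marks plateaus and \<open>z\<close> marks ascents.\<close>

definition E :: "nat \<Rightarrow> 'a \<Rightarrow> 'a \<Rightarrow> 'a \<Rightarrow> 'a::comm_semiring_1" where
  "E n x y z = (\<Sum>w\<in>Q1 n. x ^ plat w * y ^ des w * z ^ asc w)"

lemma finite_stirling_permutations: "finite (stirling_permutations M)"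
  by (simp add: stirling_permutations_def)

end

(*
  Cutting a word at its smallest letter m gives A m B m D for a doubled m and B m D for a
  single m, where A, B, D are Stirling words on disjoint sets of doubled larger letters.
  A nonempty block contributes the same weight whether it is padded by 0 or by m; an empty
  block contributes x, z, y in the positions of A, B, D respectively. The resulting
  recurrence for C is symmetric under exchange of x and z, and hence so is C in positive
  degree, by induction. Therefore the pairs (B, D) contribute exactly E, in spite of
  the exchanged roles of x and z in its definition, and the block A contributes C.
*)

theory Submission
  imports Defs
begin

section \<open>Weights of words\<close>

definition step_weight :: "'a \<Rightarrow> 'a \<Rightarrow> 'a \<Rightarrow> nat \<Rightarrow> nat \<Rightarrow> 'a" where
  "step_weight x y z a b = (if a < b then x else if b < a then y else z)"

text \<open>A product over neighbouring pairs replaces the three statistics because it factors when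
  a word is cut. Words with fewer than two letters have no step, hence weight 1.\<close>

fun walk_weight :: "('b \<Rightarrow> 'b \<Rightarrow> 'a::comm_semiring_1) \<Rightarrow> 'b list \<Rightarrow> 'a" where
  "walk_weight f (a # b # l) = f a b * walk_weight f (b # l)"
| "walk_weight f l = 1"

text \<open>The cut letter \<open>m\<close> is kept in both pieces, so that each neighbouring pair
  lies in exactly one of them.\<close>

lemma walk_weight_split:
  "walk_weight f (u @ m # v) = walk_weight f (u @ [m]) * walk_weight f (m # v)"
proof (induction u)
  case (Cons a u)
  then show ?case by (cases u) (auto simp: mult.assoc)
qed simp

lemma walk_weight_eq_prod:
  "walk_weight f l = (\<Prod>i<length l - 1. f (l ! i) (l ! (i + 1)))"
  by (induction f l rule: walk_weight.induct) (simp_all add: prod.lessThan_Suc_shift del: prod.lessThan_Suc)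

lemma statistics_eq_walk_weight:
  fixes x y z :: "'a::comm_semiring_1"
  shows "x ^ asc w * y ^ des w * z ^ plat w = walk_weight (step_weight x y z) (0 # w @ [0])"
proof -
  let ?p = "padded w" and ?I = "{0..length w}"
  have "{..<length ?p - 1} = ?I"
    by (auto simp: padded_def)
  then have "walk_weight (step_weight x y z) ?p
      = (\<Prod>i\<in>?I. step_weight x y z (?p ! i) (?p ! (i + 1)))"
    by (simp add: walk_weight_eq_prod)
  \<comment> \<open>By trichotomy exactly one of the three factors differs from the default 1;
    distributing the product then turns each indicator into a power counting its positions.\<close>
  also have "\<dots> = (\<Prod>i\<in>?I. (if ?p ! i < ?p ! (i + 1) then x else 1)
      * (if ?p ! i > ?p ! (i + 1) then y else 1) * (if ?p ! i = ?p ! (i + 1) then z else 1))"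
    by (intro prod.cong) (auto simp: step_weight_def)
  also have "\<dots> = x ^ asc w * y ^ des w * z ^ plat w"
    unfolding prod.distrib by (simp add: prod.If_cases asc_def des_def plat_def Int_def)
  finally show ?thesis
    by (simp add: padded_def)
qed

text \<open>Only the first and last steps see the padding, and they stay an ascent and a descent as
  long as both padding letters lie below the word. An empty \<open>u\<close> would leave a single
  step comparing \<open>a\<close> with \<open>b\<close>.\<close>

lemma walk_weight_change_ends:
  assumes "u \<noteq> []" "\<And>c. c \<in> set u \<Longrightarrow> a < c \<and> b < c"
  shows "walk_weight (step_weight x y z) (a # u @ [b]) = walk_weight (step_weight x y z) (0 # u @ [0])"
proof -
  have last: "walk_weight (step_weight x y z) (u @ [b]) = walk_weight (step_weight x y z) (u @ [0])"
    using assms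
  proof (induction u)
    case (Cons c u)
    have "0 < c"
      using Cons.prems(2)[of c] by simp
    with Cons show ?case
      by (cases u) (auto simp: step_weight_def)
  qed simp
  obtain c v where u: "u = c # v"
    using assms(1) by (cases u) auto
  have "a < c"
    using assms(2) u by simp
  with last u show ?thesis
    by (auto simp: step_weight_def)
qed

section \<open>Cutting a Stirling word at its smallest letter\<close>

text \<open>A letter on both sides of the cut would enclose the smaller \<open>m\<close>. The bound
  on \<open>v\<close> is weak because the cut is made at the first \<open>m\<close>, and further
  copies may follow.\<close>

lemma stirling_word_split:
  assumes "\<And>c. c \<in> set u \<Longrightarrow> m < c" "\<And>c. c \<in> set v \<Longrightarrow> m \<le> c"
  shows "stirling_word (u @ m # v) \<longleftrightarrow>
    stirling_word u \<and> stirling_word v \<and> set u \<inter> set v = {}" (is "?L \<longleftrightarrow> ?R")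
proof
  assume L: ?L
  have "stirling_word u"
    unfolding stirling_word_def
  proof (intro allI impI, elim conjE)
    fix i j k
    assume "i < j" "j < k" "k < length u" "u ! i = u ! k"
    then show "u ! i \<le> u ! j"
      using L[unfolded stirling_word_def, rule_format, of i j k] by (simp add: nth_append)
  qed
  moreover have "stirling_word v"
    unfolding stirling_word_def
  proof (intro allI impI, elim conjE)
    fix i j k
    assume "i < j" "j < k" "k < length v" "v ! i = v ! k"
    then show "v ! i \<le> v ! j"
      using L[unfolded stirling_word_def, rule_format,
          of "length u + 1 + i" "length u + 1 + j" "length u + 1 + k"]
      by (simp add: nth_append)
  qed
  moreover have False if u: "c \<in> set u" and v: "c \<in> set v" for c
  proof -
    obtain i where "i < length u" "u ! i = c"
      using u by (auto simp: in_set_conv_nth)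
    moreover obtain k where "k < length v" "v ! k = c"
      using v by (auto simp: in_set_conv_nth)
    ultimately have "c \<le> m"
      using L[unfolded stirling_word_def, rule_format, of i "length u" "length u + 1 + k"]
      by (simp add: nth_append)
    then show False
      using assms(1)[OF u] by simp
  qed
  ultimately show ?R by blast
next
  let ?w = "u @ m # v"
  assume R: ?R
  show ?L
    unfolding stirling_word_def
  proof (intro allI impI, elim conjE)
    fix i j k
    assume ijk: "i < j" "j < k" "k < length ?w" "?w ! i = ?w ! k"
    have ge: "m \<le> ?w ! j"
    proof -
      have "?w ! j \<in> set ?w"
        using ijk by (intro nth_mem) simp
      then show ?thesis
        using assms by (auto simp: less_imp_le)
    qed
    \<comment> \<open>The outer positions \<open>i\<close> and \<open>k\<close> relative to the cut.
      If one of them is the cut, the common letter is \<open>m\<close> and \<open>ge\<close>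
      suffices; if they lie strictly on opposite sides, disjointness is violated.\<close>
    consider "k < length u" | "i < length u" "k = length u" | "i < length u" "length u < k"
      | "i = length u" | "length u < i"
      by linarith
    then show "?w ! i \<le> ?w ! j"
    proof cases
      case 1
      then show ?thesis
        using R ijk by (auto simp: stirling_word_def nth_append)
    next
      case 2
      then show ?thesis
        using ijk ge by (simp add: nth_append)
    next
      case 3
      then have "?w ! i = u ! i" "?w ! k = v ! (k - length u - 1)" "k - length u - 1 < length v"
        using ijk by (auto simp: nth_append nth_Cons')
      then have "?w ! i \<in> set u" "?w ! k \<in> set v"
        using \<open>i < length u\<close> by simp_all
      then show ?thesis
        using R ijk(4) by auto
    next
      case 4
      then show ?thesis
        using ge by (simp add: nth_append)
    next
      case 5
      define i' j' k' where "i' = i - length u - 1" "j' = j - length u - 1" "k' = k - length u - 1"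
      then have "?w ! i = v ! i'" "?w ! j = v ! j'" "?w ! k = v ! k'"
        "i' < j'" "j' < k'" "k' < length v"
        using 5 ijk by (auto simp: nth_append nth_Cons')
      then show ?thesis
        using R ijk(4) unfolding stirling_word_def by metis
    qed
  qed
qed

section \<open>Stirling permutations of doubled letters and the bijection given by the first
  cut\<close>

abbreviation doubled :: "nat set \<Rightarrow> nat multiset" where
  "doubled S \<equiv> repeat_mset 2 (mset_set S)"

lemma set_mset_doubled: "finite S \<Longrightarrow> set_mset (doubled S) = S"
  by (auto simp: set_mset_def count_mset_set')

lemma mem_stirling_permutations:
  "w \<in> stirling_permutations M \<longleftrightarrow> mset w = M \<and> stirling_word w"
  by (auto simp: stirling_permutations_def permutations_of_multiset_def)

lemma set_mem_stirling_permutations: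
  "w \<in> stirling_permutations M \<Longrightarrow> set w = set_mset M"
  by (auto simp: mem_stirling_permutations simp flip: set_mset_mset)

lemma stirling_permutations_empty: "stirling_permutations {#} = {[]}"
  by (auto simp: mem_stirling_permutations stirling_word_def)

text \<open>Cutting at the first \<open>m\<close> is a bijection: both copies of any other letter
  fall on the same side, so a word amounts to the set \<open>A\<close> of letters before the cut and
  one word on each side. The parameter \<open>k\<close> counts the copies of \<open>m\<close> left
  after the cut, which covers a single minimum (\<open>k = 0\<close>) and a doubled one
  (\<open>k = 1\<close>).\<close>

lemma sum_stirling_permutations_split:
  fixes g :: "nat list \<Rightarrow> 'a::comm_semiring_1"
  assumes S: "finite S" "\<And>s. s \<in> S \<Longrightarrow> m < s"
  shows "(\<Sum>w\<in>stirling_permutations (replicate_mset (Suc k) m + doubled S). g w)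
    = (\<Sum>A\<in>Pow S. \<Sum>u\<in>stirling_permutations (doubled A).
        \<Sum>v\<in>stirling_permutations (replicate_mset k m + doubled (S - A)). g (u @ m # v))"
proof -
  let ?D = "\<lambda>A. stirling_permutations (doubled A)"
  let ?R = "\<lambda>A. stirling_permutations (replicate_mset k m + doubled (S - A))"
  let ?T = "SIGMA A:Pow S. ?D A \<times> ?R A"
  let ?i = "\<lambda>(A, u, v). u @ m # v"
  \<comment> \<open>The inverse map: stop before the first \<open>m\<close>, and let
    \<open>tl\<close> remove that copy. The set \<open>A\<close> is recovered as the set of letters
    of the left part.\<close>
  let ?u = "\<lambda>w. takeWhile (\<lambda>c. c \<noteq> m) w" and ?v = "\<lambda>w. tl (dropWhile (\<lambda>c. c \<noteq> m) w)"
  have fin: "finite (?D A)" "finite (?R A)" for A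
    by (rule finite_stirling_permutations)+
  have finA: "finite A" if "A \<subseteq> S" for A
    using that S(1) by (rule finite_subset)
  have "(\<Sum>A\<in>Pow S. \<Sum>u\<in>?D A. \<Sum>v\<in>?R A. g (u @ m # v))
      = (\<Sum>A\<in>Pow S. \<Sum>(u, v)\<in>?D A \<times> ?R A. g (u @ m # v))"
    by (simp add: sum.cartesian_product)
  also have "\<dots> = (\<Sum>t\<in>?T. g (?i t))"
    using S(1) fin by (subst sum.Sigma) (auto intro!: sum.cong)
  also have "\<dots> = (\<Sum>w\<in>stirling_permutations (replicate_mset (Suc k) m + doubled S). g w)"
  proof (rule sum.reindex_bij_witness[where i = "\<lambda>w. (set (?u w), ?u w, ?v w)" and j = ?i])
    fix t assume "t \<in> ?T"
    then obtain A u v where t: "t = (A, u, v)" and A: "A \<subseteq> S" and u: "u \<in> ?D A" and v: "v \<in> ?R A"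
      by auto
    have su: "set u = A" and sv: "set v \<subseteq> insert m (S - A)"
      using set_mem_stirling_permutations[OF u] set_mem_stirling_permutations[OF v] finA[OF A] S(1)
      by (auto simp: set_mset_doubled split: if_splits)
    have mu: "m \<notin> set u"
      using su A S(2) by blast
    show "(set (?u (?i t)), ?u (?i t), ?v (?i t)) = t"
      using mu su t by (simp add: takeWhile_append dropWhile_append)
    have "mset (u @ m # v) = replicate_mset (Suc k) m + doubled S"
    proof -
      have "mset_set S = mset_set A + mset_set (S - A)"
        using A S(1) finA[OF A] by (subst mset_set_Union[symmetric]) (auto simp: Un_absorb1)
      then show ?thesis
        using u v by (simp add: mem_stirling_permutations)
    qed
    moreover have "stirling_word (u @ m # v)"
    proof (subst stirling_word_split)
      show "m < c" if "c \<in> set u" for c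
        using that su A S(2) by blast
      show "m \<le> c" if "c \<in> set v" for c
        using that sv S(2)[of c] by fastforce
      show "stirling_word u \<and> stirling_word v \<and> set u \<inter> set v = {}"
        using u v su sv mu by (auto simp: mem_stirling_permutations)
    qed
    ultimately show "?i t \<in> stirling_permutations (replicate_mset (Suc k) m + doubled S)"
      by (simp add: t mem_stirling_permutations)
  next
    fix w assume w: "w \<in> stirling_permutations (replicate_mset (Suc k) m + doubled S)"
    define u v where "u = ?u w" and "v = ?v w"
    have sw: "set w = insert m S"
      using set_mem_stirling_permutations[OF w] S(1) by (simp add: set_mset_doubled)
    have "dropWhile (\<lambda>c. c \<noteq> m) w \<noteq> []"
      using sw by auto
    moreover from this have "hd (dropWhile (\<lambda>c. c \<noteq> m) w) = m"
      by (metis (mono_tags, lifting) hd_dropWhile)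
    ultimately have wuv: "w = u @ m # v"
      unfolding u_def v_def by (metis list.collapse takeWhile_dropWhile_id)
    then show "?i (set (?u w), ?u w, ?v w) = w"
      by (simp add: u_def v_def)
    have mu: "m \<notin> set u"
      unfolding u_def by (auto dest: set_takeWhileD)
    have suS: "set u \<subseteq> S"
      using sw wuv mu by auto
    have "stirling_word u \<and> stirling_word v \<and> set u \<inter> set v = {}"
    proof (subst stirling_word_split[symmetric])
      show "m < c" if "c \<in> set u" for c
        using that suS S(2) by blast
      show "m \<le> c" if "c \<in> set v" for c
        using that sw wuv S(2)[of c] by fastforce
      show "stirling_word (u @ m # v)"
        using w wuv by (simp add: mem_stirling_permutations)
    qed
    then have st: "stirling_word u" "stirling_word v" and disj: "set u \<inter> set v = {}"
      by auto
    \<comment> \<open>The copy of \<open>m\<close> at the cut cancels one of the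
      \<open>Suc k\<close>. By disjointness, one of the two counts vanishes for each letter, so the
      other takes the whole right-hand side.\<close>
    have cnt: "count (mset u) a + count (mset v) a
        = (if a = m then k else 0) + (if a \<in> S then 2 else 0)" for a
    proof -
      have "count (mset w) a = count (replicate_mset (Suc k) m + doubled S) a"
        using w by (simp add: mem_stirling_permutations)
      then show ?thesis
        using S(1) by (auto simp: wuv count_mset_set' split: if_splits)
    qed
    have mS: "m \<notin> S"
      using S(2) by blast
    have "mset u = doubled (set u)"
    proof (rule multiset_eqI)
      fix a
      show "count (mset u) a = count (doubled (set u)) a"
      proof (cases "a \<in> set u")
        case True
        then have "a \<notin> set v" "a \<noteq> m" "a \<in> S"
          using disj mu suS by auto
        then show ?thesis
          using cnt[of a] True by (simp add: count_mset_set' flip: count_mset_0_iff)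
      next
        case False
        then show ?thesis by (simp add: count_mset_set')
      qed
    qed
    moreover have "mset v = replicate_mset k m + doubled (S - set u)"
    proof (rule multiset_eqI)
      fix a
      show "count (mset v) a = count (replicate_mset k m + doubled (S - set u)) a"
      proof (cases "a \<in> set u")
        case True
        then have "a \<notin> set v" "a \<noteq> m"
          using disj mu by auto
        then show ?thesis
          using True S(1) by (simp add: count_mset_set')
      next
        case False
        then have "count (mset u) a = 0"
          by simp
        then have "count (mset v) a = (if a = m then k else 0) + (if a \<in> S then 2 else 0)"
          using cnt[of a] by linarith
        then show ?thesis
          using False S(1) by (simp add: count_mset_set')
      qed
    qed
    ultimately show "(set (?u w), ?u w, ?v w) \<in> ?T"
      using suS st by (auto simp: mem_stirling_permutations u_def v_def)
  qed simp_all
  finally show ?thesis ..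
qed

section \<open>Generating functions over a set of doubled letters\<close>

text \<open>The argument \<open>e\<close> is the weight of the empty block, which depends on its position.\<close>

definition block_gf :: "'a \<Rightarrow> 'a \<Rightarrow> 'a \<Rightarrow> 'a \<Rightarrow> nat set \<Rightarrow> 'a::comm_semiring_1" where
  "block_gf x y z e S = (if S = {} then e
     else \<Sum>w\<in>stirling_permutations (doubled S). walk_weight (step_weight x y z) (0 # w @ [0]))"

text \<open>For nonempty \<open>S\<close> the padding can be changed to 0; for empty
  \<open>S\<close> only the step from \<open>a\<close> to \<open>b\<close> remains, which supplies
  the empty-block weight.\<close>

lemma sum_walk_weight_block:
  assumes "finite S" "\<And>s. s \<in> S \<Longrightarrow> a < s \<and> b < s"
  shows "(\<Sum>w\<in>stirling_permutations (doubled S). walk_weight (step_weight x y z) (a # w @ [b]))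
    = block_gf x y z (step_weight x y z a b) S"
proof (cases "S = {}")
  case True
  then show ?thesis
    by (simp add: block_gf_def stirling_permutations_empty)
next
  case False
  have "walk_weight (step_weight x y z) (a # w @ [b]) = walk_weight (step_weight x y z) (0 # w @ [0])"
    if "w \<in> stirling_permutations (doubled S)" for w
  proof (rule walk_weight_change_ends)
    have "set w = S"
      using set_mem_stirling_permutations[OF that] assms(1) by (simp add: set_mset_doubled)
    then show "w \<noteq> []" "\<And>c. c \<in> set w \<Longrightarrow> a < c \<and> b < c"
      using False assms(2) by auto
  qed
  then show ?thesis
    using False by (simp add: block_gf_def)
qed

text \<open>The bounds on \<open>a\<close> and \<open>b\<close> are weak so that
  \<open>a = m\<close> is allowed: this treats the part of a word that follows the first of two
  copies of \<open>m\<close>. With \<open>a = b = 0\<close> it treats the words counted by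
  \<open>E\<close>.\<close>

lemma sum_walk_weight_single_min:
  assumes S: "finite S" "\<And>s. s \<in> S \<Longrightarrow> m < s" and "a \<le> m" "b \<le> m"
  shows "(\<Sum>w\<in>stirling_permutations (add_mset m (doubled S)).
      walk_weight (step_weight x y z) (a # w @ [b]))
    = (\<Sum>B\<in>Pow S. block_gf x y z (step_weight x y z a m) B
        * block_gf x y z (step_weight x y z m b) (S - B))"
proof -
  let ?f = "step_weight x y z"
  have "(\<Sum>w\<in>stirling_permutations (add_mset m (doubled S)). walk_weight ?f (a # w @ [b]))
      = (\<Sum>B\<in>Pow S. \<Sum>u\<in>stirling_permutations (doubled B).
          \<Sum>v\<in>stirling_permutations (doubled (S - B)).
            walk_weight ?f (a # u @ [m]) * walk_weight ?f (m # v @ [b]))"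
    using sum_stirling_permutations_split[OF S, where k = 0 and g = "\<lambda>w. walk_weight ?f (a # w @ [b])"]
    by (simp add: walk_weight_split[of ?f "a # _" m "_ @ [b]", simplified])
  also have "\<dots> = (\<Sum>B\<in>Pow S. block_gf x y z (?f a m) B * block_gf x y z (?f m b) (S - B))"
  proof (rule sum.cong[OF refl])
    fix B assume "B \<in> Pow S"
    then have "finite B" "\<And>s. s \<in> B \<Longrightarrow> a < s \<and> m < s" "finite (S - B)"
      "\<And>s. s \<in> S - B \<Longrightarrow> m < s \<and> b < s"
      using S assms(3,4) by (auto intro: finite_subset le_less_trans)
    then show "(\<Sum>u\<in>stirling_permutations (doubled B).
          \<Sum>v\<in>stirling_permutations (doubled (S - B)).
            walk_weight ?f (a # u @ [m]) * walk_weight ?f (m # v @ [b]))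
      = block_gf x y z (?f a m) B * block_gf x y z (?f m b) (S - B)"
      by (simp only: sum_walk_weight_block flip: sum_product)
  qed
  finally show ?thesis .
qed

text \<open>Two successive cuts, at the first and the second \<open>m\<close>. Empty blocks leave
  the steps from 0 to \<open>m\<close>, from \<open>m\<close> to \<open>m\<close> and from
  \<open>m\<close> to 0, with weights \<open>x\<close>, \<open>z\<close>, \<open>y\<close>.\<close>

lemma block_gf_insert_min:
  assumes S: "finite S" "\<And>s. s \<in> S \<Longrightarrow> m < s" and "0 < m"
  shows "block_gf x y z e (insert m S)
    = (\<Sum>A\<in>Pow S. block_gf x y z x A
        * (\<Sum>B\<in>Pow (S - A). block_gf x y z z B * block_gf x y z y (S - A - B)))"
proof -
  let ?f = "step_weight x y z"
  have "m \<notin> S"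
    using S(2) by blast
  then have "doubled (insert m S) = replicate_mset (Suc 1) m + doubled S"
    using S(1) by (simp add: numeral_2_eq_2)
  then have "block_gf x y z e (insert m S)
      = (\<Sum>w\<in>stirling_permutations (replicate_mset (Suc 1) m + doubled S). walk_weight ?f (0 # w @ [0]))"
    by (simp add: block_gf_def)
  also have "\<dots> = (\<Sum>A\<in>Pow S. \<Sum>u\<in>stirling_permutations (doubled A).
          \<Sum>v\<in>stirling_permutations (add_mset m (doubled (S - A))).
            walk_weight ?f (0 # u @ [m]) * walk_weight ?f (m # v @ [0]))"
    using sum_stirling_permutations_split[OF S, where k = 1 and g = "\<lambda>w. walk_weight ?f (0 # w @ [0])"]
    by (simp add: walk_weight_split[of ?f "0 # _" m "_ @ [0]", simplified])
  also have "\<dots> = (\<Sum>A\<in>Pow S. block_gf x y z x A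
        * (\<Sum>B\<in>Pow (S - A). block_gf x y z z B * block_gf x y z y (S - A - B)))"
  proof (rule sum.cong[OF refl])
    fix A assume "A \<in> Pow S"
    then have "finite A" "\<And>s. s \<in> A \<Longrightarrow> 0 < s \<and> m < s" "finite (S - A)"
      "\<And>s. s \<in> S - A \<Longrightarrow> m < s"
      using S assms(3) by (auto intro: finite_subset le_less_trans)
    moreover have "?f 0 m = x" "?f m m = z" "?f m 0 = y"
      using \<open>0 < m\<close> by (auto simp: step_weight_def)
    ultimately show "(\<Sum>u\<in>stirling_permutations (doubled A).
          \<Sum>v\<in>stirling_permutations (add_mset m (doubled (S - A))).
            walk_weight ?f (0 # u @ [m]) * walk_weight ?f (m # v @ [0]))
      = block_gf x y z x A
        * (\<Sum>B\<in>Pow (S - A). block_gf x y z z B * block_gf x y z y (S - A - B))"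
      by (simp only: sum_walk_weight_block sum_walk_weight_single_min le0 order_refl flip: sum_product)
  qed
  finally show ?thesis .
qed

text \<open>Exchanging \<open>x\<close> and \<open>z\<close> amounts to exchanging the blocks before and between the two
  copies of the smallest letter. Comparing two sets of letters at once makes the induction
  yield independence of the letters as well.\<close>

lemma block_gf_swap:
  assumes "finite S" "0 \<notin> S" "finite S'" "0 \<notin> S'" "card S = card S'"
  shows "block_gf x y z e S = block_gf z y x e S'"
  using assms
\<comment> \<open>The induction hypothesis is needed for each block with its own empty weight
  \<open>x\<close>, \<open>z\<close> or \<open>y\<close>, and for a block against its image, hence
  the generalization over \<open>e\<close> and \<open>S'\<close>.\<close>
proof (induction "card S" arbitrary: S S' e rule: less_induct)
  case less
  show ?case
  proof (cases "S = {}")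
    case True
    then have "S' = {}"
      using less.prems by simp
    with True show ?thesis
      by (simp add: block_gf_def)
  next
    case False
    then have ne': "S' \<noteq> {}"
      using less.prems by auto
    define m T m' T' where defs: "m = Min S" "T = S - {m}" "m' = Min S'" "T' = S' - {m'}"
    have m: "m \<in> S" "m' \<in> S'"
      using False ne' less.prems by (simp_all add: defs)
    then have S: "S = insert m T" "S' = insert m' T'" "0 < m" "0 < m'"
      using less.prems by (auto simp: defs intro: gr0I)
    have T: "finite T" "finite T'" "0 \<notin> T" "0 \<notin> T'" "card T = card T'" "card T < card S"
      using less.prems m card_Diff1_less[of S m] by (auto simp: defs(2,4) simp del: card_Diff1_less)
    have mT: "m < s" if "s \<in> T" for s
      using that less.prems(1) by (auto simp: defs order.strict_iff_order)
    have mT': "m' < s" if "s \<in> T'" for s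
      using that less.prems(3) by (auto simp: defs order.strict_iff_order)
    \<comment> \<open>The bijection need not respect the order of the letters, since the induction
      hypothesis compares blocks by cardinality.\<close>
    obtain h where h: "bij_betw h T T'"
      using T finite_same_card_bij by blast
    define g where "g = inv_into T h"
    have g: "bij_betw g T' T"
      unfolding g_def using h by (rule bij_betw_inv_into)
    have gh: "g ` h ` A = A" if "A \<subseteq> T" for A
      using that h unfolding g_def by (simp add: bij_betw_def inv_into_image_cancel)
    have hg: "h ` g ` A = A" if "A \<subseteq> T'" for A
      using that h unfolding g_def by (simp add: bij_betw_def image_inv_into_cancel)
    have hsub: "h ` A \<subseteq> T'" if "A \<subseteq> T" for A
      using that h by (auto simp: bij_betw_def)
    have gsub: "g ` A \<subseteq> T" if "A \<subseteq> T'" for A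
      using that g by (auto simp: bij_betw_def)
    have hdiff: "h ` (A - B) = h ` A - h ` B" if "A \<subseteq> T" "B \<subseteq> T" for A B
      using that h by (intro inj_on_image_set_diff[of h T]) (auto simp: bij_betw_def)
    have hT: "h ` T = T'"
      using h by (simp add: bij_betw_def)
    have IH: "block_gf x y z d A = block_gf z y x d (h ` A)" if "A \<subseteq> T" for A d
    proof (rule less.hyps)
      show "card A < card S"
        using that T card_mono[of T A] by simp
      show "finite A" "finite (h ` A)" "0 \<notin> A" "0 \<notin> h ` A"
        using that T hsub[OF that] by (auto intro: finite_subset)
      show "card A = card (h ` A)"
        using that h by (metis bij_betw_def card_image inj_on_subset)
    qed
    let ?P = "\<lambda>T. SIGMA A:Pow T. Pow (T - A)"
    let ?F = "\<lambda>x z T (A, B). block_gf x y z x A * (block_gf x y z z B * block_gf x y z y (T - A - B))"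
    have expand: "block_gf x y z e (insert m T) = sum (?F x z T) (?P T)"
      if "finite T" "\<And>s. s \<in> T \<Longrightarrow> m < s" "0 < m" for x z m T
      using that by (simp add: block_gf_insert_min sum_distrib_left sum.Sigma)
    have "sum (?F x z T) (?P T) = sum (?F z x T') (?P T')"
    \<comment> \<open>The image of the middle block \<open>B\<close> becomes the first block and
      that of \<open>A\<close> the middle one. In the exchanged parameters the empty weights of
      these positions are \<open>z\<close> and \<open>x\<close>, so each factor meets its
      counterpart under \<open>IH\<close>.\<close>
    proof (rule sum.reindex_bij_witness[where i = "\<lambda>(A, B). (g ` B, g ` A)" and j = "\<lambda>(A, B). (h ` B, h ` A)"])
      fix p assume "p \<in> ?P T"
      then obtain A B where p: "p = (A, B)" and AB: "A \<subseteq> T" "B \<subseteq> T" "A \<inter> B = {}"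
        by auto
      show "(case (case p of (A, B) \<Rightarrow> (h ` B, h ` A)) of (A, B) \<Rightarrow> (g ` B, g ` A)) = p"
        using AB by (simp add: p gh)
      have "h ` A \<inter> h ` B = {}"
        using AB h by (metis bij_betw_def image_empty inj_on_image_Int)
      then show "(case p of (A, B) \<Rightarrow> (h ` B, h ` A)) \<in> ?P T'"
        using hsub[OF AB(1)] hsub[OF AB(2)] by (simp add: p) blast
      have "h ` (T - A - B) = T' - h ` B - h ` A"
        using hdiff[of "T - A" B] hdiff[of T A] AB hT by auto
      moreover have "T - A - B \<subseteq> T"
        by auto
      ultimately show "?F z x T' (case p of (A, B) \<Rightarrow> (h ` B, h ` A)) = ?F x z T p"
        using AB IH by (simp add: p mult_ac)
    next
      fix p assume "p \<in> ?P T'"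
      then obtain A B where p: "p = (A, B)" and AB: "A \<subseteq> T'" "B \<subseteq> T'" "A \<inter> B = {}"
        by auto
      show "(case (case p of (A, B) \<Rightarrow> (g ` B, g ` A)) of (A, B) \<Rightarrow> (h ` B, h ` A)) = p"
        using AB by (simp add: p hg)
      have "g ` A \<inter> g ` B = {}"
        using AB g by (metis bij_betw_def image_empty inj_on_image_Int)
      then show "(case p of (A, B) \<Rightarrow> (g ` B, g ` A)) \<in> ?P T"
        using gsub[OF AB(1)] gsub[OF AB(2)] by (simp add: p) blast
    qed
    then show ?thesis
      using expand[of T m x z] expand[of T' m' z x] T S mT mT' by simp
  qed
qed

section \<open>Reduction to cardinalities and identification with \<open>C\<close> and
  \<open>E\<close>\<close>

lemma block_gf_card:
  assumes "finite S" "0 \<notin> S"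
  shows "block_gf x y z e S = block_gf x y z e {1..card S}"
  \<comment> \<open>Two swaps restore the order of \<open>x\<close> and \<open>z\<close>: one from
    \<open>S\<close> to itself, one from \<open>S\<close> to \<open>{1..card S}\<close>.\<close>
  using block_gf_swap[of S S x y z e] block_gf_swap[of S "{1..card S}" z y x e] assms by simp

lemma sum_Pow_card:
  fixes f :: "nat \<Rightarrow> 'a::comm_semiring_1"
  assumes "finite S"
  shows "(\<Sum>A\<in>Pow S. f (card A)) = (\<Sum>k=0..card S. of_nat (card S choose k) * f k)"
proof -
  have "(\<Sum>A\<in>Pow S. f (card A)) = (\<Sum>k=0..card S. \<Sum>A\<in>{A \<in> Pow S. card A = k}. f (card A))"
    using assms by (intro sum.group[symmetric]) (auto intro: card_mono)
  also have "\<dots> = (\<Sum>k=0..card S. of_nat (card S choose k) * f k)"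
    using assms by (intro sum.cong) (simp_all add: n_subsets)
  finally show ?thesis .
qed

text \<open>The convention for \<open>C 0\<close> is exactly the weight of an empty block before the
  smallest letter.\<close>

lemma C_eq_block_gf: "C k x y z = block_gf x y z x {1..k}"
  by (simp add: C_def Q_def block_gf_def statistics_eq_walk_weight)

text \<open>This is the contribution of the blocks between and after the two copies of a smallest
  letter.\<close>

definition pair_gf :: "'a \<Rightarrow> 'a \<Rightarrow> 'a \<Rightarrow> nat set \<Rightarrow> 'a::comm_semiring_1" where
  "pair_gf x y z S = (\<Sum>B\<in>Pow S. block_gf x y z z B * block_gf x y z y (S - B))"

text \<open>Its use is that the right-hand side involves \<open>S\<close> only through its size, so
  letters may be renamed.\<close>

lemma pair_gf_card:
  assumes "finite S" "0 \<notin> S"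
  shows "pair_gf x y z S = (\<Sum>j=0..card S. of_nat (card S choose j)
    * (block_gf x y z z {1..j} * block_gf x y z y {1..card S - j}))"
proof -
  have "pair_gf x y z S = (\<Sum>B\<in>Pow S. block_gf x y z z {1..card B} * block_gf x y z y {1..card S - card B})"
    unfolding pair_gf_def
  proof (rule sum.cong[OF refl])
    fix B assume "B \<in> Pow S"
    then have B: "finite B" "0 \<notin> B" "finite (S - B)" "0 \<notin> S - B" "card (S - B) = card S - card B"
      using assms by (auto intro: finite_subset simp: card_Diff_subset finite_subset)
    show "block_gf x y z z B * block_gf x y z y (S - B)
      = block_gf x y z z {1..card B} * block_gf x y z y {1..card S - card B}"
      using block_gf_card[OF B(1,2), of x y z z] block_gf_card[OF B(3,4), of x y z y] B(5) by simp
  qed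
  then show ?thesis
    using sum_Pow_card[OF assms(1), of "\<lambda>j. block_gf x y z z {1..j} * block_gf x y z y {1..card S - j}"]
    by simp
qed

text \<open>In the marking of \<open>E\<close>, an empty block before the single 1 is an ascent of
  weight \<open>z\<close>, just like an empty middle block in \<open>pair_gf\<close>, and an empty
  last block weighs \<open>y\<close> in both. Nonempty blocks agree by the symmetry in
  \<open>x\<close> and \<open>z\<close>.\<close>

lemma E_eq_pair_gf:
  assumes "finite S" "0 \<notin> S"
  shows "E (card S + 1) x y z = pair_gf x y z S"
proof -
  let ?n = "card S" and ?S = "{2..card S + 1}"
  have "E (?n + 1) x y z = (\<Sum>w\<in>stirling_permutations (add_mset 1 (doubled ?S)).
      walk_weight (step_weight z y x) (0 # w @ [0]))"
    by (simp add: E_def Q1_def mult_ac flip: statistics_eq_walk_weight)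
  also have "\<dots> = (\<Sum>B\<in>Pow ?S. block_gf z y x z B * block_gf z y x y (?S - B))"
    by (subst sum_walk_weight_single_min) (auto simp: step_weight_def)
  also have "\<dots> = (\<Sum>B\<in>Pow ?S. block_gf x y z z B * block_gf x y z y (?S - B))"
  proof (rule sum.cong[OF refl])
    fix B assume "B \<in> Pow ?S"
    then have "finite B" "0 \<notin> B"
      by (auto intro: finite_subset)
    then show "block_gf z y x z B * block_gf z y x y (?S - B) = block_gf x y z z B * block_gf x y z y (?S - B)"
      using block_gf_swap[of B B z y x z] block_gf_swap[of "?S - B" "?S - B" z y x y] by simp
  qed
  \<comment> \<open>Both \<open>S\<close> and \<open>{2..card S + 1}\<close> have
    \<open>card S\<close> elements and avoid 0.\<close>
  also have "\<dots> = pair_gf x y z S"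
    using assms by (simp add: pair_gf_card flip: pair_gf_def)
  finally show ?thesis .
qed

theorem theorem3p6:
  fixes x y z :: "'a::comm_semiring_1" and n :: nat
  shows "C (n + 1) x y z = (\<Sum>k=0..n. of_nat (n choose k) * C k x y z * E (n - k + 1) x y z)"
proof -
  let ?S = "{2..n + 1}"
  have "{1..n + 1} = insert 1 ?S"
    by auto
  then have "C (n + 1) x y z = (\<Sum>A\<in>Pow ?S. block_gf x y z x A * pair_gf x y z (?S - A))"
    by (simp only: C_eq_block_gf pair_gf_def) (rule block_gf_insert_min, auto)
  \<comment> \<open>Here \<open>A\<close> is the set of letters before the first 1. The other
    \<open>n - card A\<close> letters together with the second 1 account for the index of
    \<open>E\<close>.\<close>
  also have "\<dots> = (\<Sum>A\<in>Pow ?S. C (card A) x y z * E (n - card A + 1) x y z)"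
  proof (rule sum.cong[OF refl])
    fix A assume "A \<in> Pow ?S"
    then have A: "finite A" "0 \<notin> A" "card (?S - A) = n - card A"
      by (auto intro: finite_subset simp: card_Diff_subset finite_subset)
    then show "block_gf x y z x A * pair_gf x y z (?S - A)
      = C (card A) x y z * E (n - card A + 1) x y z"
      using E_eq_pair_gf[of "?S - A" x y z] block_gf_card[OF A(1,2), of x y z x]
      by (simp add: C_eq_block_gf)
  qed
  also have "\<dots> = (\<Sum>k=0..n. of_nat (n choose k) * C k x y z * E (n - k + 1) x y z)"
    using sum_Pow_card[of ?S "\<lambda>k. C k x y z * E (n - k + 1) x y z"] by (simp add: mult.assoc)
  finally show ?thesis .
qed

end
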